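(* Let $D=d_1,\ldots,d_n$ and $F=f_1,\ldots,f_n$ be a pair of degree and neighbor degree sequences (sequences of positive integers), and let $\Delta$ be the largest degree in $D$. Then $(D,F)$ is loopless multigraph realizable if and only if the following integer programming feasibility problem $(\mathcal{X},\mathcal{L})$ has a solution. The indeterminates $\mathcal{X}$ are the variables $x_\lambda$ for all partitions $\lambda=\lambda_1,\ldots,\lambda_{h(\lambda)}$ with $h(\lambda)\le\Delta$ and $\lambda_i\le\Delta$ for all $i$, together with auxiliary variables $p_1,\ldots,p_\Delta$, $z_1,\ldots,z_r$, $b_1,\ldots,b_r$, where $r=\sum_{i=1}^{\Delta}(4i-2)$. The system $\mathcal{L}$ consists of - for all positive integers $d,f$: $\ \sum_{\lambda\dashv f\,\wedge\,h(\lambda)=d}x_\lambda=y_{d,f}$, and $x_\lambda\ge 0$ for all $\lambda$, where $y_{d,f}$ is the number of indices $i$ with $d_i=d$ and $f_i=f$; - for all $0<i<j\le\Delta$: $\ \sum_{\lambda|h(\lambda)=i}x_\lambda N(\lambda,j)=\sum_{\lambda'|h(\lambda')=j}x_{\lambda'}N(\lambda',i)$; - for all $1\le i\le\Delta$: the equation $\sum_{\lambda|h(\lambda)=i}x_\lambda N(\lambda,i)=2p_i$; the linear system (in the variables $x_\lambda$, $z$, $b$) encoding $$z_{s(i)}=\max_{k\in\{1,\ldots,i\}}\left\{\min\left\{1,\sum_{\lambda|h(\lambda)=i\,\wedge\,N(\lambda,i)=k}x_\lambda\right\}k\right\},$$ where $z_{s(i)}$ is a designated one of the variables $z_1,\ldots,z_r$;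 and the inequality $$2z_{s(i)}\le\sum_{\lambda|h(\lambda)=i}x_\lambda N(\lambda,i).$$
   Context: $(D,F)$ is loopless multigraph realizable if there is a multigraph without loops (parallel edges allowed) on vertices $v_1,\ldots,v_n$ such that for all $k$, $d(v_k)=d_k$ and $\sum_{w\in\mathcal{N}(v_k)}d(w)=f_k$, where $d(v)$ is the degree and $\mathcal{N}(v)$ the neighbors of $v$, counted with edge multiplicity. An integer programming feasibility problem $(\mathcal{X},\mathcal{L})$ asks whether there is an integer assignment to the indeterminates $\mathcal{X}$ satisfying the system $\mathcal{L}$ of linear equations and inequalities. $\lambda\dashv f$ means that $\lambda$ is a partition of $f$ (a multiset of positive integers with sum $f$); its height $h(\lambda)$ is its number of parts; $N(\lambda,j)$ is the number of parts equal to $j$. All sums over $\lambda$ range over partitions $\lambda$ whose variable $x_\lambda$ is in $\mathcal{X}$; an empty sum is $0$. Encoding of minima and maxima: if $x,y$ are integer linear expressions and $M$ is an integer constant with $M\ge|x-y|$ for all values that occur, then $z=\min\{x,y\}$ is encoded, with an auxiliary variable $b$, by $z\le x$, $z\le y$, $z\ge x-Mb$, $z\ge y-M(1-b)$, $0\le b\le 1$; and $z=\max\{x,y\}$ by $z\ge x$, $z\ge y$, $z\le x+Mb$, $z\le y+M(1-b)$, $0\le b\le 1$. In integers these systems are solvable in $(z,b)$ exactly when $z$ equals the minimum, respectively maximum. Nested minima/maxima and maxima of more than two terms are encoded by iterating this, each operation using its own pair $(z_t,b_t)$; since all $x_\lambda$ lie between $0$ and $n$, a suitable $M$ depending only on $n$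 and $\Delta$ exists. Any of the $r$ pairs not needed are unconstrained. *)

theory Defs
  imports Main "HOL-Library.Multiset" "HOL-Library.FuncSet" "HOL-Library.Poly_Mapping"
begin

section \<open>Loopless multigraphs\<close>

text \<open>A loopless multigraph on the vertex set \<open>V\<close> is given by its multiset of edges, each edge being
  a two-element set of vertices; parallel edges are repeated elements of the multiset.\<close>

definition loopless_multigraph :: "'a set \<Rightarrow> 'a set multiset \<Rightarrow> bool" where
  "loopless_multigraph V E \<longleftrightarrow> (\<forall>e\<in>#E. e \<subseteq> V \<and> card e = 2)"

definition vertex_degree :: "'a set multiset \<Rightarrow> 'a \<Rightarrow> nat" where
  "vertex_degree E v = size {#e \<in># E. v \<in> e#}"

text \<open>The neighbours of \<open>v\<close>, with edge multiplicity: one occurrence of the other endpoint for each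
  edge at \<open>v\<close>.\<close>

definition neighbors :: "'a set multiset \<Rightarrow> 'a \<Rightarrow> 'a multiset" where
  "neighbors E v = image_mset (\<lambda>e. the_elem (e - {v})) {#e \<in># E. v \<in> e#}"

definition loopless_multigraph_realizable :: "nat list \<Rightarrow> nat list \<Rightarrow> bool" where
  "loopless_multigraph_realizable D F \<longleftrightarrow>
     (\<exists>E. loopless_multigraph {..<length D} E \<and>
          (\<forall>k<length D. vertex_degree E k = D ! k \<and> (\<Sum>w\<in>#neighbors E k. vertex_degree E w) = F ! k))"


section \<open>Integer programming feasibility\<close>

text \<open>An affine integer expression in indeterminates from \<open>'v\<close> is a formal \<open>\<int>\<close>-linear combination
  over \<open>'v option\<close>; the coefficient of \<open>None\<close> is the constant term.  Scaling is \<^const>\<open>frag_cmul\<close>.\<close>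

type_synonym 'v affine = "'v option \<Rightarrow>\<^sub>0 int"

definition ivar :: "'v \<Rightarrow> 'v affine" where
  "ivar v = frag_of (Some v)"

definition icst :: "int \<Rightarrow> 'v affine" where
  "icst c = frag_cmul c (frag_of None)"

definition affine_eval :: "('v \<Rightarrow> int) \<Rightarrow> 'v affine \<Rightarrow> int" where
  "affine_eval \<sigma> e =
     (\<Sum>u\<in>Poly_Mapping.keys e. Poly_Mapping.lookup e u * (case u of None \<Rightarrow> 1 | Some v \<Rightarrow> \<sigma> v))"

datatype 'v lin_constraint =
    LEq "'v affine" "'v affine"  (infix "=\<^sub>L" 50)
  | LLe "'v affine" "'v affine"  (infix "\<le>\<^sub>L" 50)

fun satisfies :: "('v \<Rightarrow> int) \<Rightarrow> 'v lin_constraint \<Rightarrow> bool" where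
  "satisfies \<sigma> (a =\<^sub>L b) \<longleftrightarrow> affine_eval \<sigma> a = affine_eval \<sigma> b"
| "satisfies \<sigma> (a \<le>\<^sub>L b) \<longleftrightarrow> affine_eval \<sigma> a \<le> affine_eval \<sigma> b"

definition ip_feasible :: "'v set \<Rightarrow> 'v lin_constraint set \<Rightarrow> bool" where
  "ip_feasible X L \<longleftrightarrow> (\<exists>\<sigma> \<in> X \<rightarrow>\<^sub>E (UNIV :: int set). \<forall>c\<in>L. satisfies \<sigma> c)"

text \<open>Big-\<open>M\<close> systems for \<open>z = min {x, y}\<close> and \<open>z = max {x, y}\<close> with auxiliary variable \<open>b\<close>.\<close>

definition min_system :: "int \<Rightarrow> 'v affine \<Rightarrow> 'v affine \<Rightarrow> 'v \<Rightarrow> 'v \<Rightarrow> 'v lin_constraint set" where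
  "min_system M x y z b =
     {ivar z \<le>\<^sub>L x,
      ivar z \<le>\<^sub>L y,
      x - frag_cmul M (ivar b) \<le>\<^sub>L ivar z,
      y - frag_cmul M (icst 1 - ivar b) \<le>\<^sub>L ivar z,
      icst 0 \<le>\<^sub>L ivar b,
      ivar b \<le>\<^sub>L icst 1}"

definition max_system :: "int \<Rightarrow> 'v affine \<Rightarrow> 'v affine \<Rightarrow> 'v \<Rightarrow> 'v \<Rightarrow> 'v lin_constraint set" where
  "max_system M x y z b =
     {x \<le>\<^sub>L ivar z,
      y \<le>\<^sub>L ivar z,
      ivar z \<le>\<^sub>L x + frag_cmul M (ivar b),
      ivar z \<le>\<^sub>L y + frag_cmul M (icst 1 - ivar b),
      icst 0 \<le>\<^sub>L ivar b,
      ivar b \<le>\<^sub>L icst 1}"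


section \<open>The integer program of a pair of sequences\<close>

definition is_partition_of :: "nat multiset \<Rightarrow> nat \<Rightarrow> bool"  (infix "\<stileturn>" 50) where
  "\<mu> \<stileturn> f \<longleftrightarrow> (\<forall>l\<in>#\<mu>. 0 < l) \<and> sum_mset \<mu> = f"

text \<open>The partitions with at most \<open>\<Delta>\<close> parts, all of size at most \<open>\<Delta>\<close>.  The height of a partition is
  its \<^const>\<open>size\<close>, and the number of parts equal to \<open>j\<close> is \<^term>\<open>count \<mu> j\<close>.\<close>

definition box_partitions :: "nat \<Rightarrow> nat multiset set" where
  "box_partitions \<Delta> = {\<mu>. (\<exists>f. \<mu> \<stileturn> f) \<and> size \<mu> \<le> \<Delta> \<and> (\<forall>l\<in>#\<mu>. l \<le> \<Delta>)}"

datatype ip_var = Xvar "nat multiset" | Pvar nat | Zvar nat | Bvar nat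

definition num_aux :: "nat \<Rightarrow> nat" where
  "num_aux \<Delta> = (\<Sum>i=1..\<Delta>. 4 * i - 2)"

definition ip_vars :: "nat \<Rightarrow> ip_var set" where
  "ip_vars \<Delta> = Xvar ` box_partitions \<Delta> \<union> Pvar ` {1..\<Delta>} \<union> Zvar ` {1..num_aux \<Delta>} \<union> Bvar ` {1..num_aux \<Delta>}"

definition xvar :: "nat multiset \<Rightarrow> ip_var affine" where
  "xvar \<mu> = ivar (Xvar \<mu>)"

definition num_pairs :: "nat list \<Rightarrow> nat list \<Rightarrow> nat \<Rightarrow> nat \<Rightarrow> nat" where
  "num_pairs D F d f = card {i. i < length D \<and> D ! i = d \<and> F ! i = f}"

definition count_system :: "nat list \<Rightarrow> nat list \<Rightarrow> nat \<Rightarrow> ip_var lin_constraint set" where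
  "count_system D F \<Delta> =
     {(\<Sum>\<mu> | \<mu> \<in> box_partitions \<Delta> \<and> \<mu> \<stileturn> f \<and> size \<mu> = d. xvar \<mu>) =\<^sub>L icst (int (num_pairs D F d f))
        | d f. 0 < d \<and> 0 < f}
     \<union> {icst 0 \<le>\<^sub>L xvar \<mu> | \<mu>. \<mu> \<in> box_partitions \<Delta>}"

definition edge_sum :: "nat \<Rightarrow> nat \<Rightarrow> nat \<Rightarrow> ip_var affine" where
  "edge_sum \<Delta> i j =
     (\<Sum>\<mu> | \<mu> \<in> box_partitions \<Delta> \<and> size \<mu> = i. frag_cmul (int (count \<mu> j)) (xvar \<mu>))"

definition bipartite_system :: "nat \<Rightarrow> ip_var lin_constraint set" where
  "bipartite_system \<Delta> = {edge_sum \<Delta> i j =\<^sub>L edge_sum \<Delta> j i | i j. 0 < i \<and> i < j \<and> j \<le> \<Delta>}"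

text \<open>For each \<open>i\<close>, the nested expression \<open>max {min {1, S\<^sub>k} * k | 1 \<le> k \<le> i}\<close> takes \<open>i\<close> minima and
  \<open>i - 1\<close> binary maxima, hence \<open>2 * i - 1\<close> pairs \<open>(z\<^sub>t, b\<^sub>t)\<close>.  The pairs used for \<open>i\<close> are those with
  \<open>(i - 1)\<^sup>2 < t \<le> i\<^sup>2\<close>: first the minima for \<open>k = 1, \<dots>, i\<close>, then the maxima for \<open>k = 2, \<dots>, i\<close>.  So
  the value of the whole expression is in \<open>z\<^sub>t\<close> with \<open>t = i\<^sup>2\<close>.\<close>

definition min_index :: "nat \<Rightarrow> nat \<Rightarrow> nat" where
  "min_index i k = (i - 1)^2 + k"

definition max_index :: "nat \<Rightarrow> nat \<Rightarrow> nat" where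
  "max_index i k = (i - 1)^2 + i + (k - 1)"

definition top_index :: "nat \<Rightarrow> nat" where
  "top_index i = i^2"

definition mult_sum :: "nat \<Rightarrow> nat \<Rightarrow> nat \<Rightarrow> ip_var affine" where
  "mult_sum \<Delta> i k = (\<Sum>\<mu> | \<mu> \<in> box_partitions \<Delta> \<and> size \<mu> = i \<and> count \<mu> i = k. xvar \<mu>)"

definition weighted_min :: "nat \<Rightarrow> nat \<Rightarrow> ip_var affine" where
  "weighted_min i k = frag_cmul (int k) (ivar (Zvar (min_index i k)))"

text \<open>The maximum over \<open>{1, \<dots>, k}\<close>; for \<open>k = 1\<close> there is nothing to compute.\<close>

definition partial_max :: "nat \<Rightarrow> nat \<Rightarrow> ip_var affine" where
  "partial_max i k = (if k = 1 then weighted_min i 1 else ivar (Zvar (max_index i k)))"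

definition maxmin_system :: "nat \<Rightarrow> int \<Rightarrow> nat \<Rightarrow> ip_var lin_constraint set" where
  "maxmin_system \<Delta> M i =
     (\<Union>k\<in>{1..i}. min_system M (icst 1) (mult_sum \<Delta> i k) (Zvar (min_index i k)) (Bvar (min_index i k)))
     \<union> (\<Union>k\<in>{2..i}. max_system M (partial_max i (k - 1)) (weighted_min i k)
                        (Zvar (max_index i k)) (Bvar (max_index i k)))"

definition loopless_system :: "nat \<Rightarrow> int \<Rightarrow> ip_var lin_constraint set" where
  "loopless_system \<Delta> M =
     (\<Union>i\<in>{1..\<Delta>}.
        {edge_sum \<Delta> i i =\<^sub>L frag_cmul 2 (ivar (Pvar i))}
        \<union> maxmin_system \<Delta> M i
        \<union> {frag_cmul 2 (ivar (Zvar (top_index i))) \<le>\<^sub>L edge_sum \<Delta> i i})"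

definition ip_system :: "nat list \<Rightarrow> nat list \<Rightarrow> nat \<Rightarrow> int \<Rightarrow> ip_var lin_constraint set" where
  "ip_system D F \<Delta> M = count_system D F \<Delta> \<union> bipartite_system \<Delta> \<union> loopless_system \<Delta> M"


section \<open>Well-formedness of the program\<close>

lemma finite_box_partitions: "finite (box_partitions \<Delta>)"
proof -
  have "box_partitions \<Delta> \<subseteq> mset ` {xs. set xs \<subseteq> {..\<Delta>} \<and> length xs \<le> \<Delta>}"
  proof
    fix \<mu> assume "\<mu> \<in> box_partitions \<Delta>"
    moreover obtain xs where "\<mu> = mset xs"
      using ex_mset by metis
    ultimately show "\<mu> \<in> mset ` {xs. set xs \<subseteq> {..\<Delta>} \<and> length xs \<le> \<Delta>}"
      by (auto simp: box_partitions_def)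
  qed
  then show ?thesis
    by (rule finite_subset) (simp add: finite_lists_length_le)
qed

lemma finite_ip_vars: "finite (ip_vars \<Delta>)"
  by (simp add: ip_vars_def finite_box_partitions)

lemma num_aux_eq: "num_aux \<Delta> = 2 * \<Delta>^2"
  unfolding num_aux_def by (induction \<Delta>) (auto simp: power2_eq_square algebra_simps)

lemma affine_eval_superset:
  assumes "finite A" "Poly_Mapping.keys e \<subseteq> A"
  shows "affine_eval \<sigma> e =
    (\<Sum>u\<in>A. Poly_Mapping.lookup e u * (case u of None \<Rightarrow> 1 | Some v \<Rightarrow> \<sigma> v))"
  unfolding affine_eval_def using assms
  by (intro sum.mono_neutral_left) (auto simp: in_keys_iff)

lemma affine_eval_0 [simp]: "affine_eval \<sigma> 0 = 0"
  by (simp add: affine_eval_def)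

lemma affine_eval_ivar [simp]: "affine_eval \<sigma> (ivar v) = \<sigma> v"
  by (simp add: affine_eval_def ivar_def)

lemma affine_eval_add [simp]: "affine_eval \<sigma> (a + b) = affine_eval \<sigma> a + affine_eval \<sigma> b"
proof -
  let ?A = "Poly_Mapping.keys a \<union> Poly_Mapping.keys b"
  have "Poly_Mapping.keys (a + b) \<subseteq> ?A" by (rule Poly_Mapping.keys_add)
  then show ?thesis
    by (simp add: affine_eval_superset[of ?A] lookup_add distrib_right sum.distrib)
qed

lemma affine_eval_cmul [simp]: "affine_eval \<sigma> (frag_cmul c a) = c * affine_eval \<sigma> a"
  by (subst affine_eval_superset[of "Poly_Mapping.keys a"])
     (auto simp: affine_eval_def sum_distrib_left mult.assoc)

lemma affine_eval_diff [simp]: "affine_eval \<sigma> (a - b) = affine_eval \<sigma> a - affine_eval \<sigma> b"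
  using affine_eval_add[of \<sigma> "a - b" b] by simp

lemma affine_eval_icst [simp]: "affine_eval \<sigma> (icst c) = c"
  unfolding icst_def by (simp only: affine_eval_cmul) (simp add: affine_eval_def)

lemma affine_eval_sum [simp]: "affine_eval \<sigma> (sum g A) = (\<Sum>a\<in>A. affine_eval \<sigma> (g a))"
  by (induction A rule: infinite_finite_induct) auto

definition affine_vars :: "'v affine \<Rightarrow> 'v set" where
  "affine_vars e = {v. Some v \<in> Poly_Mapping.keys e}"

fun constraint_vars :: "'v lin_constraint \<Rightarrow> 'v set" where
  "constraint_vars (a =\<^sub>L b) = affine_vars a \<union> affine_vars b"
| "constraint_vars (a \<le>\<^sub>L b) = affine_vars a \<union> affine_vars b"

lemma affine_vars_ivar [simp]: "affine_vars (ivar v) = {v}"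
  by (auto simp: affine_vars_def ivar_def)

lemma affine_vars_icst [simp]: "affine_vars (icst c) = {}"
  by (auto simp: affine_vars_def icst_def)

lemma affine_vars_add: "affine_vars a \<subseteq> X \<Longrightarrow> affine_vars b \<subseteq> X \<Longrightarrow> affine_vars (a + b) \<subseteq> X"
  using Poly_Mapping.keys_add[of a b] by (auto simp: affine_vars_def)

lemma affine_vars_diff: "affine_vars a \<subseteq> X \<Longrightarrow> affine_vars b \<subseteq> X \<Longrightarrow> affine_vars (a - b) \<subseteq> X"
  using keys_diff[of a b] by (auto simp: affine_vars_def)

lemma affine_vars_cmul: "affine_vars a \<subseteq> X \<Longrightarrow> affine_vars (frag_cmul c a) \<subseteq> X"
  by (auto simp: affine_vars_def)

lemma affine_vars_sum: "(\<And>a. a \<in> A \<Longrightarrow> affine_vars (g a) \<subseteq> X) \<Longrightarrow> affine_vars (sum g A) \<subseteq> X"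
  by (induction A rule: infinite_finite_induct) (auto simp: affine_vars_add, auto simp: affine_vars_def)

lemmas affine_vars_intros = affine_vars_add affine_vars_diff affine_vars_cmul affine_vars_sum

lemma index_bounds:
  assumes "1 \<le> i" "i \<le> \<Delta>"
  shows "1 \<le> k \<Longrightarrow> k \<le> i \<Longrightarrow> min_index i k \<in> {1..num_aux \<Delta>}"
    and "2 \<le> k \<Longrightarrow> k \<le> i \<Longrightarrow> max_index i k \<in> {1..num_aux \<Delta>}"
    and "top_index i \<in> {1..num_aux \<Delta>}"
proof -
  obtain m where m: "i = Suc m" using assms(1) by (cases i) auto
  have "i^2 \<le> \<Delta>^2" using assms(2) by (rule power_mono) simp
  then have *: "m * m + 2 * m + 1 \<le> num_aux \<Delta>"
    by (simp add: num_aux_eq m power2_eq_square)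
  show "1 \<le> k \<Longrightarrow> k \<le> i \<Longrightarrow> min_index i k \<in> {1..num_aux \<Delta>}"
    and "2 \<le> k \<Longrightarrow> k \<le> i \<Longrightarrow> max_index i k \<in> {1..num_aux \<Delta>}"
    and "top_index i \<in> {1..num_aux \<Delta>}"
    using * by (auto simp: m min_index_def max_index_def top_index_def power2_eq_square)
qed

lemma top_index_eq:
  assumes "1 \<le> i"
  shows "partial_max i i = ivar (Zvar (top_index i))"
proof -
  obtain m where "i = Suc m" using assms by (cases i) auto
  then show ?thesis
    by (auto simp: partial_max_def weighted_min_def min_index_def max_index_def top_index_def
        power2_eq_square algebra_simps)
qed

lemma ip_system_vars:
  assumes "c \<in> ip_system D F \<Delta> M"
  shows "constraint_vars c \<subseteq> ip_vars \<Delta>"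
proof -
  let ?X = "ip_vars \<Delta>"
  have x: "affine_vars (xvar \<mu>) \<subseteq> ?X" if "\<mu> \<in> box_partitions \<Delta>" for \<mu>
    using that by (simp add: xvar_def ip_vars_def)
  have e: "affine_vars (edge_sum \<Delta> i j) \<subseteq> ?X" for i j
    unfolding edge_sum_def by (intro affine_vars_intros x) auto
  have s: "affine_vars (mult_sum \<Delta> i k) \<subseteq> ?X" for i k
    unfolding mult_sum_def by (intro affine_vars_intros x) auto
  have zb: "Zvar t \<in> ?X" "Bvar t \<in> ?X" if "t \<in> {1..num_aux \<Delta>}" for t
    using that by (auto simp: ip_vars_def)
  have w: "affine_vars (weighted_min i k) \<subseteq> ?X" if "1 \<le> i" "i \<le> \<Delta>" "1 \<le> k" "k \<le> i" for i k
    unfolding weighted_min_def using that by (intro affine_vars_intros) (simp add: zb[OF index_bounds(1)])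
  have p: "affine_vars (partial_max i k) \<subseteq> ?X" if "1 \<le> i" "i \<le> \<Delta>" "1 \<le> k" "k \<le> i" for i k
    unfolding partial_max_def using that w[of i 1] zb[OF index_bounds(2), of i k] by auto
  have mn: "constraint_vars c \<subseteq> ?X"
    if "c \<in> min_system M a b z y" "affine_vars a \<subseteq> ?X" "affine_vars b \<subseteq> ?X" "z \<in> ?X" "y \<in> ?X"
    for c a b z y
    using that unfolding min_system_def
    by (elim insertE emptyE) (simp_all add: affine_vars_intros)
  have mx: "constraint_vars c \<subseteq> ?X"
    if "c \<in> max_system M a b z y" "affine_vars a \<subseteq> ?X" "affine_vars b \<subseteq> ?X" "z \<in> ?X" "y \<in> ?X"
    for c a b z y
    using that unfolding max_system_def
    by (elim insertE emptyE) (simp_all add: affine_vars_intros)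
  have count: "constraint_vars c \<subseteq> ?X" if "c \<in> count_system D F \<Delta>" for c
  proof -
    have sm: "affine_vars (\<Sum>\<mu> | \<mu> \<in> box_partitions \<Delta> \<and> \<mu> \<stileturn> f \<and> size \<mu> = d. xvar \<mu>) \<subseteq> ?X" for d f
      by (intro affine_vars_intros x) auto
    then show ?thesis
      using that unfolding count_system_def
      by (elim UnE CollectE exE conjE) (simp_all add: x sm)
  qed
  have bip: "constraint_vars c \<subseteq> ?X" if "c \<in> bipartite_system \<Delta>" for c
    using that unfolding bipartite_system_def
    by (elim CollectE exE conjE) (simp add: e)
  have mm: "constraint_vars c \<subseteq> ?X" if cm: "c \<in> maxmin_system \<Delta> M i" and i: "1 \<le> i" "i \<le> \<Delta>" for c i
  proof -
    consider k where "k \<in> {1..i}" "c \<in> min_system M (icst 1) (mult_sum \<Delta> i k)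
          (Zvar (min_index i k)) (Bvar (min_index i k))"
      | k where "k \<in> {2..i}" "c \<in> max_system M (partial_max i (k - 1)) (weighted_min i k)
          (Zvar (max_index i k)) (Bvar (max_index i k))"
      using cm unfolding maxmin_system_def by blast
    then show ?thesis
    proof cases
      case 1
      then have "min_index i k \<in> {1..num_aux \<Delta>}" using i index_bounds(1) by auto
      then show ?thesis by (intro mn[OF 1(2)] s zb) simp_all
    next
      case 2
      then have "max_index i k \<in> {1..num_aux \<Delta>}" using i index_bounds(2) by auto
      then show ?thesis using 2(1) i by (intro mx[OF 2(2)] w p zb) auto
    qed
  qed
  have loop: "constraint_vars c \<subseteq> ?X" if c: "c \<in> loopless_system \<Delta> M" for c
  proof -
    obtain i where i: "1 \<le> i" "i \<le> \<Delta>"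
      and c': "c = (edge_sum \<Delta> i i =\<^sub>L frag_cmul 2 (ivar (Pvar i))) \<or> c \<in> maxmin_system \<Delta> M i
        \<or> c = (frag_cmul 2 (ivar (Zvar (top_index i))) \<le>\<^sub>L edge_sum \<Delta> i i)"
      using c unfolding loopless_system_def by auto
    have "Pvar i \<in> ?X" using i by (auto simp: ip_vars_def)
    moreover have "Zvar (top_index i) \<in> ?X" using i by (intro zb index_bounds)
    ultimately show ?thesis
      using c' mm i by (elim disjE) (simp_all add: e affine_vars_cmul)
  qed
  show ?thesis
    using assms count bip loop unfolding ip_system_def by blast
qed

end

theory Submission
  imports Defs "HOL-Library.Discrete_Functions"
begin

text \<open>The variable \<open>x\<^sub>\<lambda>\<close> of the program counts the vertices whose neighbours have degrees \<open>\<lambda>\<close>, so the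
equations with \<open>y\<^bsub>d,f\<^esub>\<close> say exactly that these numbers arise, for nonempty \<open>\<lambda>\<close>, from an assignment of a partition of \<open>f\<^sub>k\<close> with
\<open>d\<^sub>k\<close> parts to each vertex \<open>v\<^sub>k\<close> (\<open>count_system_iff\<close>; one direction hands out the partitions one vertex
at a time, \<open>exists_fun_with_fibre_sizes\<close>).  The question is then which assignments \<open>l\<close> of multisets
of labels to vertices, labelled by their degrees, come from a loopless multigraph.

Think of \<open>l v\<close> as the half-edges at \<open>v\<close>, each marked with the label of the vertex where it has to end.
A half-edge at a vertex labelled \<open>i\<close> that is marked \<open>j\<close> can only be glued to one at a vertex labelled
\<open>j\<close> that is marked \<open>i\<close>.  For \<open>i \<noteq> j\<close> this is possible as soon as both kinds are equally numerous, and
no loop can arise.  For \<open>i = j\<close> it is the classical problem of loopless multigraphs with given degrees: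
the total has to be even, and no vertex may own more than half of it.  These conditions are called
\<open>balanced\<close> below, and \<open>labelled_loopless_multigraph_exists_iff\<close> shows that they are necessary (adding an
edge preserves them) and sufficient (an edge can be split off such that they persist).

Since no part of an assigned partition is \<open>0\<close> or exceeds \<open>\<Delta>\<close>, the conditions only concern labels from \<open>1\<close>
to \<open>\<Delta>\<close>, and for those they are the remaining constraints of the program: \<open>2 p\<^sub>i\<close> expresses evenness, and the
nested maximum is the largest number of half-edges marked \<open>i\<close> at a single vertex labelled \<open>i\<close>
(\<open>balanced_iff_satisfies\<close>).\<close>

section \<open>Multigraphs with prescribed neighbour labels\<close>

lemma loopless_multigraph_induct [consumes 1, case_names empty add]:
  assumes "loopless_multigraph V E"
    and "P {#}"
    and "\<And>u w E. u \<in> V \<Longrightarrow> w \<in> V \<Longrightarrow> u \<noteq> w \<Longrightarrow> loopless_multigraph V E \<Longrightarrow> P E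
           \<Longrightarrow> P (add_mset {u, w} E)"
  shows "P E"
  using assms(1)
proof (induction E)
  case empty
  show ?case by (rule assms(2))
next
  case (add e E)
  then have "e \<subseteq> V" "card e = 2" and E: "loopless_multigraph V E"
    by (auto simp: loopless_multigraph_def)
  then obtain u w where "e = {u, w}" "u \<noteq> w" "u \<in> V" "w \<in> V"
    by (auto simp: card_2_iff)
  then show ?case
    using assms(3) add.IH E by blast
qed

lemma neighbors_empty [simp]: "neighbors {#} v = {#}"
  by (simp add: neighbors_def)

lemma neighbors_add_edge:
  assumes "u \<noteq> w"
  shows "neighbors (add_mset {u, w} E) v =
    neighbors E v + (if v = u then {#w#} else if v = w then {#u#} else {#})"
proof -
  have "{u, w} - {u} = {w}" "{u, w} - {w} = {u}"
    using assms by auto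
  then show ?thesis
    using assms by (auto simp: neighbors_def)
qed

lemma size_neighbors [simp]: "size (neighbors E v) = vertex_degree E v"
  by (simp add: neighbors_def vertex_degree_def)

lemma neighbors_subset:
  assumes "loopless_multigraph V E"
  shows "set_mset (neighbors E v) \<subseteq> V"
  using assms
  by (induction rule: loopless_multigraph_induct) (auto simp: neighbors_add_edge split: if_splits)

text \<open>Here \<open>d\<close> labels the vertices, and \<open>l v\<close> lists the half-edges at \<open>v\<close>, each represented by its mark.  The first label
\<open>i\<close> is that of the vertex, the second label \<open>j\<close> is the mark.\<close>

definition half_edges ::
    "'a set \<Rightarrow> ('a \<Rightarrow> 'b) \<Rightarrow> ('a \<Rightarrow> 'b multiset) \<Rightarrow> 'b \<Rightarrow> 'b \<Rightarrow> nat" where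
  "half_edges V d l i j = (\<Sum>v | v \<in> V \<and> d v = i. count (l v) j)"

definition balanced :: "'a set \<Rightarrow> ('a \<Rightarrow> 'b) \<Rightarrow> ('a \<Rightarrow> 'b multiset) \<Rightarrow> bool" where
  "balanced V d l \<longleftrightarrow>
     (\<forall>i j. half_edges V d l i j = half_edges V d l j i) \<and>
     (\<forall>i. even (half_edges V d l i i)) \<and>
     (\<forall>v\<in>V. 2 * count (l v) (d v) \<le> half_edges V d l (d v) (d v))"

text \<open>Both directions of the characterization compare two assignments \<open>l\<close> and \<open>l'\<close> that differ by one edge
between \<open>u\<close> and \<open>w\<close>.  On the diagonal the edge counts twice in the total but at most once at each vertex,
which is why half of the total bounds the share of a vertex.\<close>

lemma half_edges_add_edge:
  assumes "finite V" "u \<in> V" "w \<in> V" "u \<noteq> w"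
    and l': "\<forall>v\<in>V. l' v = l v + (if v = u then {#d w#} else if v = w then {#d u#} else {#})"
  shows "half_edges V d l' i j =
      half_edges V d l i j + of_bool (d u = i \<and> d w = j) + of_bool (d u = j \<and> d w = i)"
    and "half_edges V d l' i i = half_edges V d l i i + 2 * of_bool (d u = i \<and> d w = i)"
    and "x \<in> V \<Longrightarrow> count (l' x) (d x) =
      count (l x) (d x) + of_bool (x \<in> {u, w} \<and> d u = d x \<and> d w = d x)"
proof -
  have *: "half_edges V d l' i j =
      half_edges V d l i j + of_bool (d u = i \<and> d w = j) + of_bool (d u = j \<and> d w = i)" for i j
  proof -
    let ?A = "{v \<in> V. d v = i}"
    have "half_edges V d l' i j =
        (\<Sum>v\<in>?A. count (l v) j + (if v = u then of_bool (d w = j) else 0)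
          + (if v = w then of_bool (d u = j) else 0))"
      unfolding half_edges_def using assms(4) by (intro sum.cong) (auto simp: l')
    then show ?thesis
      using assms(1-3) by (auto simp: sum.distrib half_edges_def)
  qed
  show "half_edges V d l' i j =
      half_edges V d l i j + of_bool (d u = i \<and> d w = j) + of_bool (d u = j \<and> d w = i)"
    by (rule *)
  show "half_edges V d l' i i = half_edges V d l i i + 2 * of_bool (d u = i \<and> d w = i)"
    unfolding *[of i i] by (cases "d u = i \<and> d w = i") simp_all
  show "count (l' x) (d x) =
      count (l x) (d x) + of_bool (x \<in> {u, w} \<and> d u = d x \<and> d w = d x)" if "x \<in> V"
    using assms(4) l' that by auto
qed

lemma balanced_add_edge:
  assumes "finite V" "u \<in> V" "w \<in> V" "u \<noteq> w" and bal: "balanced V d l"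
    and l': "\<forall>v\<in>V. l' v = l v + (if v = u then {#d w#} else if v = w then {#d u#} else {#})"
  shows "balanced V d l'"
  unfolding balanced_def
proof (intro conjI allI ballI)
  let ?H = "half_edges V d l" and ?H' = "half_edges V d l'"
  note add = half_edges_add_edge[OF assms(1-4) l']
  show "?H' i j = ?H' j i" for i j
  proof -
    have "?H i j = ?H j i"
      using bal unfolding balanced_def by blast
    then show ?thesis
      unfolding add(1)[of i j] add(1)[of j i] by linarith
  qed
  show "even (?H' i i)" for i
  proof -
    have "even (?H i i)"
      using bal unfolding balanced_def by blast
    then show ?thesis
      unfolding add(2)[of i] by simp
  qed
  show "2 * count (l' x) (d x) \<le> ?H' (d x) (d x)" if "x \<in> V" for x
  proof -
    have le: "2 * count (l x) (d x) \<le> ?H (d x) (d x)"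
      using bal that unfolding balanced_def by blast
    have of_bool_le: "of_bool (p \<and> q) \<le> (of_bool q :: nat)" for p q
      by simp
    from add_mono[OF le mult_le_mono2[OF this, of 2]] show ?thesis
      unfolding add(2)[of "d x"] add(3)[OF \<open>x \<in> V\<close>] distrib_left .
  qed
qed

text \<open>Between different labels any two matching half-edges may be glued.  Within one label \<open>i\<close> one end \<open>u\<close> is
chosen with the largest number of half-edges marked \<open>i\<close>, and the other end is arbitrary: a third vertex \<open>x\<close>
stays within half of the reduced total, since it has no more than \<open>u\<close>, and \<open>w\<close> has at least one.\<close>

lemma balanced_remove_edge:
  assumes fin: "finite V" and bal: "balanced V d l" and v: "v \<in> V" "l v \<noteq> {#}"
  obtains u w where "u \<in> V" "w \<in> V" "u \<noteq> w" "d w \<in># l u" "d u \<in># l w"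
    "balanced V d (l(u := l u - {#d w#}, w := l w - {#d u#}))"
proof -
  let ?H = "half_edges V d l"
  have sym: "?H i j = ?H j i" and ev: "even (?H i i)" for i j
    using bal by (auto simp: balanced_def)
  have le: "2 * count (l x) (d x) \<le> ?H (d x) (d x)" if "x \<in> V" for x
    using bal that by (auto simp: balanced_def)
  obtain j where j: "j \<in># l v"
    using v(2) by auto
  have pos: "\<exists>x\<in>V. d x = i \<and> k \<in># l x" if "0 < ?H i k" for i k
  proof (rule ccontr)
    assume "\<not> ?thesis"
    then have "?H i k = 0"
      by (auto simp: half_edges_def not_in_iff)
    then show False
      using that by simp
  qed
  have Hv: "0 < ?H (d v) j"
  proof -
    have "count (l v) j \<le> ?H (d v) j"
      unfolding half_edges_def using fin v(1) by (intro member_le_sum) auto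
    then show ?thesis
      using j count_greater_zero_iff[of "l v" j] by linarith
  qed
  obtain u w where uw: "u \<in> V" "w \<in> V" "u \<noteq> w" "d w \<in># l u" "d u \<in># l w"
    and max: "d u = d w \<Longrightarrow> x \<in> V \<Longrightarrow> d x = d u \<Longrightarrow> count (l x) (d u) \<le> count (l u) (d u)" for x
  proof (cases "d v = j")
    case False
    obtain w where "w \<in> V" "d w = j" "d v \<in># l w"
      using pos[of j "d v"] Hv by (auto simp: sym)
    then show ?thesis
      using that[of v w] False v(1) j by auto
  next
    case True
    \<comment> \<open>The vertex with the largest share owns at most half of a positive total, so another one has some.\<close>
    let ?A = "{x \<in> V. d x = j}"
    have A: "finite ?A" "?A \<noteq> {}"
      using fin v(1) True by auto
    then have "(MAX x\<in>?A. count (l x) j) \<in> (\<lambda>x. count (l x) j) ` ?A"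
      by (intro Max_in) auto
    then obtain u where u: "u \<in> ?A" and Max: "(MAX x\<in>?A. count (l x) j) = count (l u) j"
      by auto
    have max: "count (l x) j \<le> count (l u) j" if "x \<in> ?A" for x
      unfolding Max[symmetric] using A(1) that by (intro Max_ge) auto
    have "?H j j = count (l u) j + (\<Sum>x\<in>?A - {u}. count (l x) j)"
      unfolding half_edges_def using A(1) u by (rule sum.remove)
    moreover have "2 * count (l u) j \<le> ?H j j" "0 < ?H j j"
      using le[of u] u Hv True by auto
    ultimately have "(\<Sum>x\<in>?A - {u}. count (l x) j) \<noteq> 0"
      by linarith
    then obtain w where w: "w \<in> ?A - {u}" "count (l w) j \<noteq> 0"
      by (meson sum.neutral)
    then have "count (l u) j \<noteq> 0"
      using max[of w] by (metis DiffD1 le_zero_eq)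
    then have "j \<in># l u" "j \<in># l w"
      using w by (metis not_in_iff)+
    then show ?thesis
      using that[of u w] u w max by auto
  qed
  define l0 where "l0 = l(u := l u - {#d w#}, w := l w - {#d u#})"
  let ?K = "half_edges V d l0"
  have "\<forall>x\<in>V. l x = l0 x + (if x = u then {#d w#} else if x = w then {#d u#} else {#})"
    using uw by (simp add: l0_def)
  note add = half_edges_add_edge[OF fin uw(1-3) this]
  have K_sym: "?K i k = ?K k i" for i k
    using sym[of i k] unfolding add(1)[of i k] add(1)[of k i] by linarith
  have K_even: "even (?K i i)" for i
    using ev[of i] unfolding add(2)[of i] by simp
  have K_le: "2 * count (l0 x) (d x) \<le> ?K (d x) (d x)" if x: "x \<in> V" for x
  proof (cases "d u = d x \<and> d w = d x \<and> x \<notin> {u, w}")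
    case False
    then have "(x \<in> {u, w} \<and> d u = d x \<and> d w = d x) = (d u = d x \<and> d w = d x)"
      by blast
    then show ?thesis
      using le[OF x] unfolding add(2)[of "d x"] add(3)[OF x] by simp
  next
    case True
    have "{u, w, x} \<subseteq> {y \<in> V. d y = d x}"
      using uw(1,2) x True by simp
    then have "(\<Sum>y\<in>{u, w, x}. count (l y) (d x)) \<le> ?H (d x) (d x)"
      unfolding half_edges_def by (intro sum_mono2) (simp_all add: fin)
    moreover have "u \<noteq> x" "w \<noteq> x"
      using True by auto
    ultimately have "count (l u) (d x) + count (l w) (d x) + count (l x) (d x) \<le> ?H (d x) (d x)"
      using uw(3) by simp
    moreover have "count (l x) (d x) \<le> count (l u) (d x)"
      using max[OF _ x] True by metis
    moreover have "0 < count (l w) (d x)"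
      using uw(5) True by (metis count_greater_zero_iff)
    moreover have "count (l0 x) (d x) = count (l x) (d x)"
      using True by (simp add: l0_def)
    moreover have "?H (d x) (d x) = ?K (d x) (d x) + 2"
      unfolding add(2)[of "d x"] using True by simp
    moreover obtain m where "?H (d x) (d x) = 2 * m"
      using ev[of "d x"] by (rule evenE)
    \<comment> \<open>Here \<open>2 * count (l x) (d x)\<close> is smaller than the even total, hence smaller by at least two.\<close>
    moreover from calculation have "count (l x) (d x) < m"
      by linarith
    ultimately show ?thesis
      by linarith
  qed
  have "balanced V d l0"
    unfolding balanced_def
    by (intro conjI allI ballI) (rule K_sym, rule K_even, erule K_le)
  then show ?thesis
    by (intro that[OF uw]) (simp only: l0_def)
qed

text \<open>Sufficiency is by induction on the number of half-edges: an edge is split off with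
\<open>balanced_remove_edge\<close> and added to a multigraph for the rest.\<close>

theorem labelled_loopless_multigraph_exists_iff:
  assumes fin: "finite V"
  shows "(\<exists>E. loopless_multigraph V E \<and> (\<forall>v\<in>V. image_mset d (neighbors E v) = l v))
    \<longleftrightarrow> balanced V d l"
proof
  assume "\<exists>E. loopless_multigraph V E \<and> (\<forall>v\<in>V. image_mset d (neighbors E v) = l v)"
  then obtain E where E: "loopless_multigraph V E" and l: "\<forall>v\<in>V. image_mset d (neighbors E v) = l v"
    by blast
  from E l show "balanced V d l"
  proof (induction arbitrary: l rule: loopless_multigraph_induct)
    case empty
    have "half_edges V d l i j = 0" for i j
      using empty by (auto simp: half_edges_def)
    then show ?case
      using empty by (auto simp: balanced_def)
  next
    case (add u w E)
    show ?case
      by (rule balanced_add_edge[OF fin add.hyps(1-3) add.IH[of "\<lambda>v. image_mset d (neighbors E v)"]])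
        (use add in \<open>auto simp: neighbors_add_edge[OF add.hyps(3)] simp flip: add.prems\<close>)
  qed
next
  assume "balanced V d l"
  then show "\<exists>E. loopless_multigraph V E \<and> (\<forall>v\<in>V. image_mset d (neighbors E v) = l v)"
  proof (induction "\<Sum>v\<in>V. size (l v)" arbitrary: l rule: less_induct)
    case less
    show ?case
    proof (cases "\<forall>v\<in>V. l v = {#}")
      case True
      then have "loopless_multigraph V {#} \<and> (\<forall>v\<in>V. image_mset d (neighbors {#} v) = l v)"
        by (simp add: loopless_multigraph_def)
      then show ?thesis by blast
    next
      case False
      then obtain v where "v \<in> V" "l v \<noteq> {#}"
        by blast
      with fin less.prems obtain u w where uw: "u \<in> V" "w \<in> V" "u \<noteq> w" "d w \<in># l u" "d u \<in># l w"
        and bal: "balanced V d (l(u := l u - {#d w#}, w := l w - {#d u#}))" (is "balanced V d ?l0")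
        by (rule balanced_remove_edge)
      have "(\<Sum>v\<in>V. size (?l0 v)) < (\<Sum>v\<in>V. size (l v))"
        by (rule sum_strict_mono_ex1[OF fin])
          (use uw in \<open>auto intro!: bexI[of _ u] size_Diff1_le size_Diff1_less\<close>)
      from less.hyps[OF this bal] obtain E where E: "loopless_multigraph V E"
        and nb: "\<forall>v\<in>V. image_mset d (neighbors E v) = ?l0 v"
        by blast
      have "loopless_multigraph V (add_mset {u, w} E)"
        using E uw by (simp add: loopless_multigraph_def)
      moreover have "\<forall>v\<in>V. image_mset d (neighbors (add_mset {u, w} E) v) = l v"
        using nb uw by (auto simp: neighbors_add_edge)
      ultimately show ?thesis by blast
    qed
  qed
qed

text \<open>The degrees of a realization are not known before it is built, but the sizes of the multisets \<open>l k\<close> force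
them: labelling vertex \<open>k\<close> with its prescribed degree \<open>D ! k\<close> makes labels and degrees agree afterwards.\<close>

lemma loopless_multigraph_realizable_iff_balanced:
  "loopless_multigraph_realizable D F \<longleftrightarrow>
     (\<exists>l. balanced {..<length D} ((!) D) l \<and>
          (\<forall>k<length D. size (l k) = D ! k \<and> sum_mset (l k) = F ! k))"
proof
  assume "loopless_multigraph_realizable D F"
  then obtain E where E: "loopless_multigraph {..<length D} E"
    and DF: "\<And>k. k < length D \<Longrightarrow> vertex_degree E k = D ! k"
      "\<And>k. k < length D \<Longrightarrow> (\<Sum>w\<in>#neighbors E k. vertex_degree E w) = F ! k"
    by (auto simp: loopless_multigraph_realizable_def)
  let ?l = "\<lambda>k. image_mset ((!) D) (neighbors E k)"
  have "balanced {..<length D} ((!) D) ?l"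
    using labelled_loopless_multigraph_exists_iff[of "{..<length D}" "(!) D" ?l] E by auto
  moreover have "sum_mset (?l k) = F ! k" if "k < length D" for k
  proof -
    have "?l k = image_mset (vertex_degree E) (neighbors E k)"
      using neighbors_subset[OF E, of k] DF(1) by (intro image_mset_cong) auto
    then show ?thesis
      using DF(2)[OF that] by simp
  qed
  ultimately have "balanced {..<length D} ((!) D) ?l \<and>
      (\<forall>k<length D. size (?l k) = D ! k \<and> sum_mset (?l k) = F ! k)"
    using DF(1) by simp
  then show "\<exists>l. balanced {..<length D} ((!) D) l \<and>
      (\<forall>k<length D. size (l k) = D ! k \<and> sum_mset (l k) = F ! k)"
    by blast
next
  assume "\<exists>l. balanced {..<length D} ((!) D) l \<and>
      (\<forall>k<length D. size (l k) = D ! k \<and> sum_mset (l k) = F ! k)"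
  then obtain l where bal: "balanced {..<length D} ((!) D) l"
    and l: "\<And>k. k < length D \<Longrightarrow> size (l k) = D ! k" "\<And>k. k < length D \<Longrightarrow> sum_mset (l k) = F ! k"
    by blast
  from bal obtain E where E: "loopless_multigraph {..<length D} E"
    and nb: "\<And>k. k < length D \<Longrightarrow> image_mset ((!) D) (neighbors E k) = l k"
    using labelled_loopless_multigraph_exists_iff[of "{..<length D}" "(!) D" l] by auto
  have deg: "vertex_degree E k = D ! k" if "k < length D" for k
    using arg_cong[OF nb[OF that], of size] l(1)[OF that] by simp
  moreover have "(\<Sum>w\<in>#neighbors E k. vertex_degree E w) = F ! k" if "k < length D" for k
  proof -
    have "image_mset (vertex_degree E) (neighbors E k) = l k"
      unfolding nb[OF that, symmetric]
      using neighbors_subset[OF E, of k] deg by (intro image_mset_cong) auto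
    then show ?thesis
      using l(2)[OF that] by simp
  qed
  ultimately show "loopless_multigraph_realizable D F"
    unfolding loopless_multigraph_realizable_def using E by blast
qed

section \<open>Assignments with prescribed fibre sizes\<close>

text \<open>The elements of \<open>P\<close> are types with multiplicities \<open>x\<close>, and each element of \<open>I\<close> is to be given a type of its
sort.  They can be served one after the other in any order: as long as the totals agree for each sort, some
type of the required sort has positive multiplicity, and using it up once keeps the totals equal.\<close>

lemma exists_fun_with_fibre_sizes:
  fixes x :: "'b \<Rightarrow> nat"
  assumes "finite I" "finite P"
    and "\<And>c. (\<Sum>p | p \<in> P \<and> q p = c. x p) = card {k \<in> I. key k = c}"
  shows "\<exists>g. (\<forall>k\<in>I. g k \<in> P \<and> q (g k) = key k) \<and> (\<forall>p\<in>P. card {k \<in> I. g k = p} = x p)"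
  using assms(1,3)
proof (induction I arbitrary: x)
  case empty
  then have "x p = 0" if "p \<in> P" for p
    using empty.prems[of "q p"] \<open>finite P\<close> that by simp
  then show ?case by simp
next
  case (insert a I)
  have "(\<Sum>p | p \<in> P \<and> q p = key a. x p) \<noteq> 0"
    using insert.hyps(1) by (auto simp: insert.prems)
  then obtain p where "p \<in> {p \<in> P. q p = key a}" "x p \<noteq> 0"
    by (meson sum.neutral)
  then have p: "p \<in> P" "q p = key a" "x p \<noteq> 0"
    by simp_all
  let ?x = "x(p := x p - 1)"
  have "(\<Sum>p | p \<in> P \<and> q p = c. ?x p) = card {k \<in> I. key k = c}" for c
  proof (cases "c = key a")
    case True
    let ?A = "{r \<in> P. q r = c}"
    have A: "finite ?A" "p \<in> ?A"
      using \<open>finite P\<close> p True by auto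
    have "{k \<in> insert a I. key k = c} = insert a {k \<in> I. key k = c}"
      using True by auto
    then have "sum x ?A = Suc (card {k \<in> I. key k = c})"
      using insert.hyps by (simp add: insert.prems)
    moreover have "sum x ?A = x p + sum x (?A - {p})" "sum ?x ?A = ?x p + sum ?x (?A - {p})"
      by (rule sum.remove[OF A])+
    moreover have "sum ?x (?A - {p}) = sum x (?A - {p})"
      by (rule sum.cong) auto
    ultimately show ?thesis
      using p(3) by simp
  next
    case False
    then have "{k \<in> insert a I. key k = c} = {k \<in> I. key k = c}"
      by auto
    moreover have "(\<Sum>p | p \<in> P \<and> q p = c. ?x p) = (\<Sum>p | p \<in> P \<and> q p = c. x p)"
      using False p(2) by (intro sum.cong) auto
    ultimately show ?thesis
      by (simp add: insert.prems)
  qed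
  from insert.IH[OF this] obtain g where g: "\<forall>k\<in>I. g k \<in> P \<and> q (g k) = key k"
    "\<forall>r\<in>P. card {k \<in> I. g k = r} = ?x r"
    by blast
  let ?g = "g(a := p)"
  have "card {k \<in> insert a I. ?g k = r} = x r" if r: "r \<in> P" for r
  proof (cases "r = p")
    case True
    then have "{k \<in> insert a I. ?g k = r} = insert a {k \<in> I. g k = p}"
      using insert.hyps(2) by auto
    then show ?thesis
      using True g(2) p insert.hyps by simp
  next
    case False
    then have "{k \<in> insert a I. ?g k = r} = {k \<in> I. g k = r}"
      using insert.hyps(2) by auto
    then show ?thesis
      using False g(2) r by simp
  qed
  moreover have "\<forall>k\<in>insert a I. ?g k \<in> P \<and> q (?g k) = key k"
    using g(1) p insert.hyps(2) by auto
  ultimately show ?case by blast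
qed

lemma sum_fibre_sizes:
  fixes h :: "'b \<Rightarrow> int"
  assumes "finite I" "finite T" "\<And>k. k \<in> I \<Longrightarrow> R (g k) \<Longrightarrow> g k \<in> T"
  shows "(\<Sum>p | p \<in> T \<and> R p. h p * int (card {k \<in> I. g k = p})) = (\<Sum>k | k \<in> I \<and> R (g k). h (g k))"
proof -
  have "(\<Sum>p | p \<in> T \<and> R p. h p * int (card {k \<in> I. g k = p}))
      = (\<Sum>p | p \<in> T \<and> R p. \<Sum>k\<in>{k \<in> {k \<in> I. R (g k)}. g k = p}. h (g k))"
  proof (rule sum.cong[OF refl])
    fix p assume "p \<in> {p \<in> T. R p}"
    then have "{k \<in> {k \<in> I. R (g k)}. g k = p} = {k \<in> I. g k = p}"
      by auto
    then show "h p * int (card {k \<in> I. g k = p}) = (\<Sum>k\<in>{k \<in> {k \<in> I. R (g k)}. g k = p}. h (g k))"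
      by simp
  qed
  also have "\<dots> = (\<Sum>k | k \<in> I \<and> R (g k). h (g k))"
    using assms by (intro sum.group) auto
  finally show ?thesis .
qed

section \<open>Solutions of the integer program\<close>

text \<open>A solution of the program is by definition undefined outside its indeterminates.  No constraint
sees that part, so solutions can be taken to be arbitrary functions.\<close>

lemma satisfies_restrict:
  assumes "constraint_vars c \<subseteq> X"
  shows "satisfies (restrict \<sigma> X) c \<longleftrightarrow> satisfies \<sigma> c"
proof -
  have "affine_eval (restrict \<sigma> X) e = affine_eval \<sigma> e" if "affine_vars e \<subseteq> X" for e
    unfolding affine_eval_def
    using that by (intro sum.cong) (auto simp: affine_vars_def split: option.split)
  then show ?thesis
    using assms by (cases c) auto
qed

lemma ip_feasible_iff:
  assumes "\<And>c. c \<in> L \<Longrightarrow> constraint_vars c \<subseteq> X"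
  shows "ip_feasible X L \<longleftrightarrow> (\<exists>\<sigma>. \<forall>c\<in>L. satisfies \<sigma> c)"
proof
  assume "\<exists>\<sigma>. \<forall>c\<in>L. satisfies \<sigma> c"
  then obtain \<sigma> where "\<forall>c\<in>L. satisfies \<sigma> c" by blast
  then have "\<forall>c\<in>L. satisfies (restrict \<sigma> X) c"
    using assms by (simp add: satisfies_restrict)
  then show "ip_feasible X L"
    unfolding ip_feasible_def by (intro bexI[of _ "restrict \<sigma> X"]) auto
qed (auto simp: ip_feasible_def)

text \<open>Either value of \<open>b\<close> makes one of the last bounds on \<open>z\<close> tight, so that \<open>z\<close> equals one of \<open>x\<close> and \<open>y\<close>; the first two
bounds say that it is the smaller, respectively larger one.  Conversely \<open>b\<close> has to select that one, and then the
remaining bound holds because \<open>M\<close> is large.\<close>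

lemma min_system_sound:
  assumes "\<forall>c\<in>min_system M x y z b. satisfies \<sigma> c"
  shows "\<sigma> z = min (affine_eval \<sigma> x) (affine_eval \<sigma> y)"
proof -
  have "\<sigma> b = 0 \<or> \<sigma> b = 1"
    using assms by (auto simp: min_system_def)
  then show ?thesis
    using assms by (auto simp: min_system_def)
qed

lemma max_system_sound:
  assumes "\<forall>c\<in>max_system M x y z b. satisfies \<sigma> c"
  shows "\<sigma> z = max (affine_eval \<sigma> x) (affine_eval \<sigma> y)"
proof -
  have "\<sigma> b = 0 \<or> \<sigma> b = 1"
    using assms by (auto simp: max_system_def)
  then show ?thesis
    using assms by (auto simp: max_system_def)
qed

lemma min_system_complete:
  assumes "\<bar>affine_eval \<sigma> x - affine_eval \<sigma> y\<bar> \<le> M"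
    and "\<sigma> z = min (affine_eval \<sigma> x) (affine_eval \<sigma> y)"
    and "\<sigma> b = of_bool (affine_eval \<sigma> y < affine_eval \<sigma> x)"
  shows "\<forall>c\<in>min_system M x y z b. satisfies \<sigma> c"
  using assms by (auto simp: min_system_def)

lemma max_system_complete:
  assumes "\<bar>affine_eval \<sigma> x - affine_eval \<sigma> y\<bar> \<le> M"
    and "\<sigma> z = max (affine_eval \<sigma> x) (affine_eval \<sigma> y)"
    and "\<sigma> b = of_bool (affine_eval \<sigma> x < affine_eval \<sigma> y)"
  shows "\<forall>c\<in>max_system M x y z b. satisfies \<sigma> c"
  using assms by (auto simp: max_system_def)

text \<open>The nested expression of the program, for arbitrary values \<open>S j\<close> of the inner sums.\<close>

definition capped_max :: "(nat \<Rightarrow> int) \<Rightarrow> nat \<Rightarrow> int" where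
  "capped_max S k = (MAX j\<in>{1..k}. int j * min 1 (S j))"

lemma capped_max_1 [simp]: "capped_max S (Suc 0) = min 1 (S 1)"
  by (simp add: capped_max_def)

lemma capped_max_Suc:
  assumes "1 \<le> k"
  shows "capped_max S (Suc k) = max (capped_max S k) (int (Suc k) * min 1 (S (Suc k)))"
proof -
  have "{1..Suc k} = insert (Suc k) {1..k}"
    by auto
  then show ?thesis
    using assms unfolding capped_max_def by (simp add: max.commute del: of_nat_Suc)
qed

lemma capped_max_attained:
  assumes "1 \<le> k"
  obtains j where "1 \<le> j" "j \<le> k" "capped_max S k = int j * min 1 (S j)"
proof -
  have "capped_max S k \<in> (\<lambda>j. int j * min 1 (S j)) ` {1..k}"
    unfolding capped_max_def using assms by (intro Max_in) auto
  then show ?thesis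
    using that by auto
qed

text \<open>The auxiliary variables of the maxima hold the partial maxima over \<open>{1..k}\<close>, so the last one holds the
whole expression.\<close>

lemma maxmin_system_sound:
  assumes sat: "\<forall>c\<in>maxmin_system \<Delta> M i. satisfies \<sigma> c" and i: "1 \<le> i"
  shows "\<sigma> (Zvar (top_index i)) = capped_max (\<lambda>k. affine_eval \<sigma> (mult_sum \<Delta> i k)) i"
proof -
  let ?S = "\<lambda>k. affine_eval \<sigma> (mult_sum \<Delta> i k)"
  have mn: "\<sigma> (Zvar (min_index i k)) = min 1 (?S k)" if "k \<in> {1..i}" for k
  proof -
    have "\<forall>c\<in>min_system M (icst 1) (mult_sum \<Delta> i k) (Zvar (min_index i k)) (Bvar (min_index i k)).
        satisfies \<sigma> c"
      using sat that unfolding maxmin_system_def by blast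
    from min_system_sound[OF this] show ?thesis by simp
  qed
  have mx: "\<sigma> (Zvar (max_index i k)) =
      max (affine_eval \<sigma> (partial_max i (k - 1))) (affine_eval \<sigma> (weighted_min i k))" if "k \<in> {2..i}" for k
  proof -
    have "\<forall>c\<in>max_system M (partial_max i (k - 1)) (weighted_min i k)
        (Zvar (max_index i k)) (Bvar (max_index i k)). satisfies \<sigma> c"
      using sat that unfolding maxmin_system_def by blast
    from max_system_sound[OF this] show ?thesis .
  qed
  have "affine_eval \<sigma> (partial_max i k) = capped_max ?S k" if "1 \<le> k" "k \<le> i" for k
    using that
  proof (induction k rule: nat_induct_at_least)
    case base
    then show ?case
      using mn[of 1] by (simp add: partial_max_def weighted_min_def)
  next
    case (Suc k)
    have "affine_eval \<sigma> (partial_max i (Suc k)) = \<sigma> (Zvar (max_index i (Suc k)))"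
      using Suc.hyps by (simp add: partial_max_def)
    also have "\<dots> = max (affine_eval \<sigma> (partial_max i k)) (affine_eval \<sigma> (weighted_min i (Suc k)))"
      using mx[of "Suc k"] Suc by simp
    also have "\<dots> = capped_max ?S (Suc k)"
      using Suc mn[of "Suc k"] by (simp add: capped_max_Suc weighted_min_def del: of_nat_Suc)
    finally show ?case .
  qed
  from this[of i] show ?thesis
    using i by (simp add: top_index_eq)
qed

text \<open>To solve the max-min systems for all \<open>i\<close> by one assignment, the value of an auxiliary variable has to be
read off from its index \<open>t\<close>.  The indices used for \<open>i\<close> are those with \<open>(i - 1)\<^sup>2 < t \<le> i\<^sup>2\<close>, so an integer square
root recovers \<open>i\<close>, the block of \<open>t\<close>.  The offset of \<open>t\<close> in its block is \<open>k\<close> for the minimum number \<open>k\<close>, and \<open>i + k - 1\<close>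
for the maximum over \<open>{1..k}\<close>.\<close>

definition block :: "nat \<Rightarrow> nat" where
  "block t = Suc (floor_sqrt (t - 1))"

definition offset :: "nat \<Rightarrow> nat" where
  "offset t = t - (block t - 1)\<^sup>2"

definition aux_z :: "(nat \<Rightarrow> nat \<Rightarrow> int) \<Rightarrow> nat \<Rightarrow> int" where
  "aux_z S t = (let i = block t; k = offset t in
     if k \<le> i then min 1 (S i k) else capped_max (S i) (k - i + 1))"

definition aux_b :: "(nat \<Rightarrow> nat \<Rightarrow> int) \<Rightarrow> nat \<Rightarrow> int" where
  "aux_b S t = (let i = block t; k = offset t in
     if k \<le> i then of_bool (S i k < 1)
     else of_bool (capped_max (S i) (k - i) < int (k - i + 1) * min 1 (S i (k - i + 1))))"

lemma block_eq:
  assumes "1 \<le> i" "1 \<le> k" "k \<le> 2 * i - 1"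
  shows "block ((i - 1)\<^sup>2 + k) = i" "offset ((i - 1)\<^sup>2 + k) = k"
proof -
  obtain m where m: "i = Suc m" using assms(1) by (cases i) auto
  have "floor_sqrt (m\<^sup>2 + k - 1) = m"
    using assms by (intro floor_sqrt_unique) (auto simp: m power2_eq_square)
  then show "block ((i - 1)\<^sup>2 + k) = i"
    by (simp add: block_def m)
  then show "offset ((i - 1)\<^sup>2 + k) = k"
    by (simp add: offset_def)
qed

lemma aux_min_index:
  assumes "1 \<le> k" "k \<le> i"
  shows "aux_z S (min_index i k) = min 1 (S i k)" "aux_b S (min_index i k) = of_bool (S i k < 1)"
proof -
  have "block (min_index i k) = i" "offset (min_index i k) = k"
    unfolding min_index_def by (rule block_eq; use assms in simp)+
  then show "aux_z S (min_index i k) = min 1 (S i k)" "aux_b S (min_index i k) = of_bool (S i k < 1)"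
    using assms by (simp_all add: aux_z_def aux_b_def)
qed

lemma aux_max_index:
  assumes "2 \<le> k" "k \<le> i"
  shows "aux_z S (max_index i k) = capped_max (S i) k"
    and "aux_b S (max_index i k) = of_bool (capped_max (S i) (k - 1) < int k * min 1 (S i k))"
proof -
  obtain m where m: "k = Suc (Suc m)"
    using assms(1) by (metis One_nat_def Suc_1 add_Suc le_Suc_ex plus_1_eq_Suc)
  have "block (max_index i k) = i" "offset (max_index i k) = i + (k - 1)"
    unfolding max_index_def add.assoc by (rule block_eq; use assms in simp)+
  then show "aux_z S (max_index i k) = capped_max (S i) k"
    and "aux_b S (max_index i k) = of_bool (capped_max (S i) (k - 1) < int k * min 1 (S i k))"
    by (simp_all add: m aux_z_def aux_b_def Let_def)
qed

text \<open>All compared quantities lie between \<open>0\<close> and \<open>M\<close>, the operands of the maxima because they are at most \<open>i\<close>, so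
\<open>M\<close> bounds their differences.\<close>

lemma maxmin_system_complete:
  assumes i: "1 \<le> i" "int i \<le> M" and M: "1 \<le> M"
    and S: "\<And>k. affine_eval \<sigma> (mult_sum \<Delta> i k) = S i k" "\<And>k. 0 \<le> S i k" "\<And>k. S i k \<le> M"
    and zb: "\<And>t. \<sigma> (Zvar t) = aux_z S t" "\<And>t. \<sigma> (Bvar t) = aux_b S t"
  shows "\<forall>c\<in>maxmin_system \<Delta> M i. satisfies \<sigma> c"
proof -
  have w: "affine_eval \<sigma> (weighted_min i k) = int k * min 1 (S i k)" if "1 \<le> k" "k \<le> i" for k
    using that by (simp add: weighted_min_def zb aux_min_index)
  have p: "affine_eval \<sigma> (partial_max i k) = capped_max (S i) k" if "1 \<le> k" "k \<le> i" for k
    using that i(1) by (auto simp: partial_max_def w zb aux_max_index)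
  have bound: "0 \<le> int k * min 1 (S i k) \<and> int k * min 1 (S i k) \<le> M" if "k \<le> i" for k
    using that i S(2)[of k] by (cases "S i k = 0") auto
  have "\<forall>c\<in>min_system M (icst 1) (mult_sum \<Delta> i k) (Zvar (min_index i k)) (Bvar (min_index i k)).
      satisfies \<sigma> c" if "k \<in> {1..i}" for k
    using that M S(2)[of k] S(3)[of k]
    by (intro min_system_complete) (auto simp: S(1) zb aux_min_index)
  moreover have "\<forall>c\<in>max_system M (partial_max i (k - 1)) (weighted_min i k)
      (Zvar (max_index i k)) (Bvar (max_index i k)). satisfies \<sigma> c" if k: "k \<in> {2..i}" for k
  proof (rule max_system_complete)
    have k': "1 \<le> k - 1" "Suc (k - 1) = k"
      using k by auto
    obtain j where j: "j \<le> k - 1" "capped_max (S i) (k - 1) = int j * min 1 (S i j)"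
      using capped_max_attained[OF k'(1), of "S i"] by metis
    have vals: "affine_eval \<sigma> (partial_max i (k - 1)) = int j * min 1 (S i j)"
      "affine_eval \<sigma> (weighted_min i k) = int k * min 1 (S i k)"
      using p[of "k - 1"] w[of k] k k' j(2) by auto
    have "\<bar>a - b\<bar> \<le> M" if "0 \<le> a \<and> a \<le> M" "0 \<le> b \<and> b \<le> M" for a b
      using that by linarith
    then show "\<bar>affine_eval \<sigma> (partial_max i (k - 1)) - affine_eval \<sigma> (weighted_min i k)\<bar> \<le> M"
      unfolding vals using bound[of j] bound[of k] j(1) k by auto
    show "\<sigma> (Zvar (max_index i k)) =
        max (affine_eval \<sigma> (partial_max i (k - 1))) (affine_eval \<sigma> (weighted_min i k))"
      using k k' capped_max_Suc[OF k'(1), of "S i"] by (auto simp: w p zb aux_max_index)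
    show "\<sigma> (Bvar (max_index i k)) =
        of_bool (affine_eval \<sigma> (partial_max i (k - 1)) < affine_eval \<sigma> (weighted_min i k))"
      using k by (auto simp: w p zb aux_max_index)
  qed
  ultimately show ?thesis
    unfolding maxmin_system_def by blast
qed

section \<open>From vertices to partitions and back\<close>

text \<open>The empty partition is left out: it belongs to no vertex of positive degree, and the program only
asks its variable to be nonnegative.\<close>

definition counts_vertices ::
    "(ip_var \<Rightarrow> int) \<Rightarrow> nat \<Rightarrow> nat list \<Rightarrow> (nat \<Rightarrow> nat multiset) \<Rightarrow> bool" where
  "counts_vertices \<sigma> \<Delta> D l \<longleftrightarrow>
     (\<forall>k<length D. l k \<in> box_partitions \<Delta> \<and> size (l k) = D ! k) \<and>
     (\<forall>\<mu>\<in>box_partitions \<Delta>. \<mu> \<noteq> {#} \<longrightarrow>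
        \<sigma> (Xvar \<mu>) = int (card {k \<in> {..<length D}. l k = \<mu>}))"

text \<open>Grouping the vertices by their partitions turns the linear expressions of the program into the half-edge
counts of the assignment.\<close>

lemma counts_vertices_sum:
  assumes "counts_vertices \<sigma> \<Delta> D l" "\<And>\<mu>. R \<mu> \<Longrightarrow> \<mu> \<noteq> {#}"
  shows "(\<Sum>\<mu> | \<mu> \<in> box_partitions \<Delta> \<and> R \<mu>. h \<mu> * \<sigma> (Xvar \<mu>)) =
    (\<Sum>k | k < length D \<and> R (l k). h (l k))"
proof -
  have "(\<Sum>\<mu> | \<mu> \<in> box_partitions \<Delta> \<and> R \<mu>. h \<mu> * \<sigma> (Xvar \<mu>)) =
      (\<Sum>\<mu> | \<mu> \<in> box_partitions \<Delta> \<and> R \<mu>. h \<mu> * int (card {k \<in> {..<length D}. l k = \<mu>}))"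
    using assms by (intro sum.cong) (auto simp: counts_vertices_def)
  also have "\<dots> = (\<Sum>k | k \<in> {..<length D} \<and> R (l k). h (l k))"
    using assms(1) by (intro sum_fibre_sizes finite_box_partitions) (auto simp: counts_vertices_def)
  finally show ?thesis by simp
qed

lemma counts_vertices_edge_sum:
  assumes "counts_vertices \<sigma> \<Delta> D l" "0 < i"
  shows "affine_eval \<sigma> (edge_sum \<Delta> i j) = int (half_edges {..<length D} ((!) D) l i j)"
proof -
  have nonempty: "\<mu> \<noteq> {#}" if "size \<mu> = i" for \<mu> :: "nat multiset"
    using that assms(2) by auto
  have "affine_eval \<sigma> (edge_sum \<Delta> i j) =
      (\<Sum>k | k < length D \<and> size (l k) = i. int (count (l k) j))"
    unfolding edge_sum_def xvar_def
    by (simp add: counts_vertices_sum[OF assms(1) nonempty])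
  also have "\<dots> = (\<Sum>k | k < length D \<and> D ! k = i. int (count (l k) j))"
    using assms(1) by (intro sum.cong) (auto simp: counts_vertices_def)
  finally show ?thesis
    by (simp add: half_edges_def)
qed

lemma counts_vertices_mult_sum:
  assumes "counts_vertices \<sigma> \<Delta> D l" "0 < i"
  shows "affine_eval \<sigma> (mult_sum \<Delta> i k) = int (card {v. v < length D \<and> D ! v = i \<and> count (l v) i = k})"
proof -
  have nonempty: "\<mu> \<noteq> {#}" if "size \<mu> = i \<and> count \<mu> i = k" for \<mu> :: "nat multiset"
    using that assms(2) by auto
  have "affine_eval \<sigma> (mult_sum \<Delta> i k) =
      (\<Sum>v | v < length D \<and> size (l v) = i \<and> count (l v) i = k. 1)"
    unfolding mult_sum_def xvar_def
    using counts_vertices_sum[OF assms(1) nonempty, where h = "\<lambda>_. 1"] by simp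
  also have "\<dots> = (\<Sum>v | v < length D \<and> D ! v = i \<and> count (l v) i = k. 1)"
    using assms(1) by (intro sum.cong) (auto simp: counts_vertices_def)
  finally show ?thesis by simp
qed

text \<open>Partitions and vertices are both sorted by the pair of height and sum, respectively of degree and neighbour
degree.  The equations make the numbers agree for positive pairs; for the other pairs both numbers are \<open>0\<close>.\<close>

lemma count_system_iff:
  assumes "\<forall>d\<in>set D. 0 < d" and "\<forall>f\<in>set F. 0 < f" and "length F = length D"
  shows "(\<forall>c\<in>count_system D F \<Delta>. satisfies \<sigma> c) \<longleftrightarrow>
    (\<exists>l. counts_vertices \<sigma> \<Delta> D l \<and> (\<forall>k<length D. sum_mset (l k) = F ! k)) \<and> 0 \<le> \<sigma> (Xvar {#})"
    (is "?L \<longleftrightarrow> ?R")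
proof
  assume L: ?L
  have sums: "(\<Sum>\<mu> | \<mu> \<in> box_partitions \<Delta> \<and> \<mu> \<stileturn> f \<and> size \<mu> = d. \<sigma> (Xvar \<mu>)) = int (num_pairs D F d f)"
    if "0 < d" "0 < f" for d f
  proof -
    have "satisfies \<sigma> ((\<Sum>\<mu> | \<mu> \<in> box_partitions \<Delta> \<and> \<mu> \<stileturn> f \<and> size \<mu> = d. xvar \<mu>)
        =\<^sub>L icst (int (num_pairs D F d f)))"
      using L that unfolding count_system_def by blast
    then show ?thesis by (simp add: xvar_def)
  qed
  have nonneg: "0 \<le> \<sigma> (Xvar \<mu>)" if "\<mu> \<in> box_partitions \<Delta>" for \<mu>
  proof -
    have "satisfies \<sigma> (icst 0 \<le>\<^sub>L xvar \<mu>)"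
      using L that unfolding count_system_def by blast
    then show ?thesis by (simp add: xvar_def)
  qed
  define P where "P = {\<mu> \<in> box_partitions \<Delta>. \<mu> \<noteq> {#}}"
  have P: "finite P"
    by (simp add: P_def finite_box_partitions)
  have "(\<Sum>\<mu> | \<mu> \<in> P \<and> (size \<mu>, sum_mset \<mu>) = c. nat (\<sigma> (Xvar \<mu>))) =
      card {k \<in> {..<length D}. (D ! k, F ! k) = c}" for c
  proof -
    obtain d f where c: "c = (d, f)" by (cases c)
    show ?thesis
    proof (cases "0 < d \<and> 0 < f")
      case True
      have "{\<mu> \<in> P. (size \<mu>, sum_mset \<mu>) = c} = {\<mu> \<in> box_partitions \<Delta>. \<mu> \<stileturn> f \<and> size \<mu> = d}"
        using True by (auto simp: P_def c box_partitions_def is_partition_of_def)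
      moreover have "int (\<Sum>\<mu> | \<mu> \<in> box_partitions \<Delta> \<and> \<mu> \<stileturn> f \<and> size \<mu> = d. nat (\<sigma> (Xvar \<mu>))) =
          (\<Sum>\<mu> | \<mu> \<in> box_partitions \<Delta> \<and> \<mu> \<stileturn> f \<and> size \<mu> = d. \<sigma> (Xvar \<mu>))"
        unfolding of_nat_sum using nonneg by (intro sum.cong) auto
      moreover have "card {k \<in> {..<length D}. (D ! k, F ! k) = c} = num_pairs D F d f"
        by (simp add: c num_pairs_def)
      ultimately show ?thesis
        using sums[of d f] True by (metis (no_types, lifting) of_nat_eq_iff)
    next
      case False
      have "\<not> (\<mu> \<in> P \<and> (size \<mu>, sum_mset \<mu>) = c)" for \<mu>
        using False by (cases \<mu>) (auto simp: P_def c box_partitions_def is_partition_of_def)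
      moreover have "\<not> (k < length D \<and> (D ! k, F ! k) = c)" for k
        unfolding c using False assms by (metis not_gr_zero nth_mem prod.inject)
      ultimately have "{\<mu> \<in> P. (size \<mu>, sum_mset \<mu>) = c} = {}"
        "{k \<in> {..<length D}. (D ! k, F ! k) = c} = {}"
        by blast+
      then show ?thesis
        by (simp only: sum.empty card.empty)
    qed
  qed
  from exists_fun_with_fibre_sizes[OF finite_lessThan P this] obtain l
    where l: "\<forall>k\<in>{..<length D}. l k \<in> P \<and> (size (l k), sum_mset (l k)) = (D ! k, F ! k)"
      "\<forall>\<mu>\<in>P. card {k \<in> {..<length D}. l k = \<mu>} = nat (\<sigma> (Xvar \<mu>))"
    by blast
  have "counts_vertices \<sigma> \<Delta> D l" "\<forall>k<length D. sum_mset (l k) = F ! k"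
    using l nonneg by (auto simp: counts_vertices_def P_def)
  then show ?R
    using nonneg[of "{#}"] by (auto simp: box_partitions_def is_partition_of_def)
next
  assume ?R
  then obtain l where l: "counts_vertices \<sigma> \<Delta> D l" "\<And>k. k < length D \<Longrightarrow> sum_mset (l k) = F ! k"
    and "0 \<le> \<sigma> (Xvar {#})"
    by blast
  then have "0 \<le> \<sigma> (Xvar \<mu>)" if "\<mu> \<in> box_partitions \<Delta>" for \<mu>
    using that by (cases "\<mu> = {#}") (auto simp: counts_vertices_def)
  moreover have "(\<Sum>\<mu> | \<mu> \<in> box_partitions \<Delta> \<and> \<mu> \<stileturn> f \<and> size \<mu> = d. \<sigma> (Xvar \<mu>)) = int (num_pairs D F d f)"
    if "0 < d" for d f
  proof -
    have nonempty: "\<mu> \<noteq> {#}" if "\<mu> \<stileturn> f \<and> size \<mu> = d" for \<mu>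
      using that \<open>0 < d\<close> by auto
    have "(\<Sum>\<mu> | \<mu> \<in> box_partitions \<Delta> \<and> \<mu> \<stileturn> f \<and> size \<mu> = d. \<sigma> (Xvar \<mu>)) =
        (\<Sum>k | k < length D \<and> l k \<stileturn> f \<and> size (l k) = d. 1)"
      using counts_vertices_sum[OF l(1) nonempty, where h = "\<lambda>_. 1"] by simp
    also have "\<dots> = (\<Sum>k | k < length D \<and> D ! k = d \<and> F ! k = f. 1)"
      using l by (intro sum.cong) (auto simp: counts_vertices_def box_partitions_def is_partition_of_def)
    finally show ?thesis
      by (simp add: num_pairs_def)
  qed
  ultimately show ?L
    by (auto simp: count_system_def xvar_def)
qed

text \<open>The program compares labels with \<open>i < j\<close> in the range \<open>1, \<dots>, \<Delta>\<close> only.  Outside that range there are neither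
vertices nor marks, hence no half-edges.  The bound on the nested maximum is the bound for single vertices:
a term \<open>k\<close> of the maximum is switched on exactly if some vertex of degree \<open>i\<close> has \<open>k\<close> neighbours of degree \<open>i\<close>.\<close>

lemma balanced_iff_satisfies:
  assumes D: "\<forall>d\<in>set D. 0 < d \<and> d \<le> \<Delta>"
    and l: "counts_vertices \<sigma> \<Delta> D l"
  shows "balanced {..<length D} ((!) D) l \<longleftrightarrow>
    (\<forall>c\<in>bipartite_system \<Delta>. satisfies \<sigma> c) \<and>
    (\<forall>i\<in>{1..\<Delta>}. even (affine_eval \<sigma> (edge_sum \<Delta> i i)) \<and>
       2 * capped_max (\<lambda>k. affine_eval \<sigma> (mult_sum \<Delta> i k)) i \<le> affine_eval \<sigma> (edge_sum \<Delta> i i))"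
    (is "?L \<longleftrightarrow> ?B \<and> ?C")
proof -
  let ?H = "half_edges {..<length D} ((!) D) l"
  let ?S = "\<lambda>i k. affine_eval \<sigma> (mult_sum \<Delta> i k)"
  note e = counts_vertices_edge_sum[OF l] and S = counts_vertices_mult_sum[OF l]
  have zero: "?H i j = 0" if "i = 0 \<or> \<Delta> < i \<or> j = 0 \<or> \<Delta> < j" for i j
  proof -
    have "D ! v \<noteq> i \<or> j \<notin># l v" if "v < length D" for v
    proof -
      have "0 < D ! v" "D ! v \<le> \<Delta>" using D that by simp_all
      moreover have "l v \<in> box_partitions \<Delta>"
        using l that by (simp add: counts_vertices_def)
      ultimately show ?thesis
        using \<open>i = 0 \<or> \<Delta> < i \<or> j = 0 \<or> \<Delta> < j\<close>
        by (force simp: box_partitions_def is_partition_of_def)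
    qed
    then show ?thesis
      by (auto simp: half_edges_def not_in_iff)
  qed
  have B: "?B \<longleftrightarrow> (\<forall>i j. ?H i j = ?H j i)"
  proof
    assume ?B
    then have less: "?H i j = ?H j i" if "0 < i" "i < j" "j \<le> \<Delta>" for i j
      using that e[of i j] e[of j i] by (fastforce simp: bipartite_system_def)
    show "\<forall>i j. ?H i j = ?H j i"
    proof (intro allI)
      fix i j
      show "?H i j = ?H j i"
      proof (cases "i = 0 \<or> \<Delta> < i \<or> j = 0 \<or> \<Delta> < j")
        case True
        then show ?thesis using zero[of i j] zero[of j i] by auto
      next
        case False
        then show ?thesis
          using less[of i j] less[of j i] by (cases i j rule: linorder_cases) auto
      qed
    qed
  next
    assume "\<forall>i j. ?H i j = ?H j i"
    then show ?B
      by (auto simp: bipartite_system_def e)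
  qed
  have C: "?C \<longleftrightarrow> (\<forall>i. even (?H i i)) \<and> (\<forall>v<length D. 2 * count (l v) (D ! v) \<le> ?H (D ! v) (D ! v))"
  proof
    assume c: ?C
    have "even (?H i i)" for i
    proof (cases "i \<in> {1..\<Delta>}")
      case True
      then have "even (affine_eval \<sigma> (edge_sum \<Delta> i i))"
        using c by blast
      then show ?thesis
        using True by (simp add: e)
    next
      case False
      then show ?thesis
        using zero[of i i] by auto
    qed
    moreover have "2 * count (l v) (D ! v) \<le> ?H (D ! v) (D ! v)" if v: "v < length D" for v
    proof (cases "count (l v) (D ! v) = 0")
      case False
      define i k where "i = D ! v" and "k = count (l v) (D ! v)"
      have i: "1 \<le> i" "i \<le> \<Delta>"
        using D v by (auto simp: i_def Suc_le_eq)
      have "k \<le> i"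
        using l v count_le_size[of "l v" i] by (simp add: counts_vertices_def i_def k_def)
      have "0 < card {u. u < length D \<and> D ! u = i \<and> count (l u) i = k}"
        using v by (auto simp: card_gt_0_iff i_def k_def)
      then have "1 \<le> ?S i k"
        using i S[of i k] by linarith
      then have "min 1 (?S i k) = 1"
        by (rule min_absorb1)
      then have "int k \<le> capped_max (?S i) i"
        unfolding capped_max_def using False \<open>k \<le> i\<close>
        by (intro Max_ge) (auto simp: k_def intro!: image_eqI[where x = k])
      moreover have "2 * capped_max (?S i) i \<le> int (?H i i)"
        using c i by (simp add: e)
      ultimately show ?thesis
        by (simp add: i_def k_def)
    qed simp
    ultimately show "(\<forall>i. even (?H i i)) \<and> (\<forall>v<length D. 2 * count (l v) (D ! v) \<le> ?H (D ! v) (D ! v))"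
      by blast
  next
    assume c: "(\<forall>i. even (?H i i)) \<and> (\<forall>v<length D. 2 * count (l v) (D ! v) \<le> ?H (D ! v) (D ! v))"
    have "2 * capped_max (?S i) i \<le> int (?H i i)" if i: "i \<in> {1..\<Delta>}" for i
    proof -
      obtain k where k: "capped_max (?S i) i = int k * min 1 (?S i k)"
        using capped_max_attained[of i "?S i"] i by auto
      show ?thesis
      proof (cases "?S i k = 0")
        case True
        then show ?thesis by (simp add: k)
      next
        case False
        then obtain v where "v < length D" "D ! v = i" "count (l v) i = k"
          using i by (auto simp: S card_eq_0_iff)
        then have "2 * k \<le> ?H i i"
          using c by blast
        moreover have "0 \<le> ?S i k"
          using i S[of i k] by simp
        then have "min 1 (?S i k) = 1"
          using False by (intro min_absorb1) linarith
        ultimately show ?thesis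
          by (simp add: k)
      qed
    qed
    then show ?C
      using c by (auto simp: e)
  qed
  show ?thesis
    unfolding B C by (auto simp: balanced_def)
qed

theorem theorem18:
  fixes D F :: "nat list" and \<Delta> :: nat and M :: int
  assumes "D \<noteq> []" and "length F = length D"
    and "\<forall>d\<in>set D. 0 < d" and "\<forall>f\<in>set F. 0 < f"
    and "\<Delta> = Max (set D)"
    and "int (length D) \<le> M" and "int \<Delta> \<le> M"
  shows "loopless_multigraph_realizable D F \<longleftrightarrow> ip_feasible (ip_vars \<Delta>) (ip_system D F \<Delta> M)"
proof -
  have D: "\<forall>d\<in>set D. 0 < d \<and> d \<le> \<Delta>"
    using assms(3,5) by simp
  note count_iff = count_system_iff[OF assms(3,4,2)]
  have "loopless_multigraph_realizable D F \<longleftrightarrow> (\<exists>\<sigma>. \<forall>c\<in>ip_system D F \<Delta> M. satisfies \<sigma> c)"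
  proof
    assume "loopless_multigraph_realizable D F"
    then obtain l where bal: "balanced {..<length D} ((!) D) l"
      and l: "\<And>k. k < length D \<Longrightarrow> size (l k) = D ! k" "\<And>k. k < length D \<Longrightarrow> sum_mset (l k) = F ! k"
      by (auto simp: loopless_multigraph_realizable_iff_balanced)
    \<comment> \<open>A mark \<open>j\<close> at \<open>k\<close> has a matching half-edge, so \<open>j\<close> is itself a degree; hence all \<open>l k\<close> are in the box.\<close>
    have parts: "0 < j \<and> j \<le> \<Delta>" if k: "k < length D" and j: "j \<in># l k" for k j
    proof -
      have "0 < (\<Sum>v | v \<in> {..<length D} \<and> D ! v = D ! k. count (l v) j)"
        using k j by (intro sum_pos2[where i = k]) auto
      also have "\<dots> = half_edges {..<length D} ((!) D) l (D ! k) j"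
        by (simp add: half_edges_def)
      also have "\<dots> = half_edges {..<length D} ((!) D) l j (D ! k)"
        using bal by (simp add: balanced_def)
      finally have "half_edges {..<length D} ((!) D) l j (D ! k) \<noteq> 0"
        by simp
      then obtain v where "v \<in> {v \<in> {..<length D}. D ! v = j}"
        unfolding half_edges_def by (meson sum.neutral)
      then show ?thesis
        using D by auto
    qed
    define S where "S i k = int (card {v. v < length D \<and> D ! v = i \<and> count (l v) i = k})" for i k
    define \<sigma> where "\<sigma> = (\<lambda>y. case y of
        Xvar \<mu> \<Rightarrow> int (card {k \<in> {..<length D}. l k = \<mu>})
      | Pvar i \<Rightarrow> int (half_edges {..<length D} ((!) D) l i i) div 2
      | Zvar t \<Rightarrow> aux_z S t
      | Bvar t \<Rightarrow> aux_b S t)"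
    have cv: "counts_vertices \<sigma> \<Delta> D l"
      unfolding counts_vertices_def box_partitions_def is_partition_of_def
      using parts D l by (auto simp: \<sigma>_def)
    note e = counts_vertices_edge_sum[OF cv] and
      B = balanced_iff_satisfies[OF D cv, THEN iffD1, OF bal]
    have S: "affine_eval \<sigma> (mult_sum \<Delta> i k) = S i k" if "0 < i" for i k
      using counts_vertices_mult_sum[OF cv that] by (simp add: S_def)
    have mm: "\<forall>c\<in>maxmin_system \<Delta> M i. satisfies \<sigma> c" if i: "i \<in> {1..\<Delta>}" for i
    proof (rule maxmin_system_complete)
      show "1 \<le> i" "int i \<le> M" "1 \<le> M"
        using i assms(7) by auto
      show "0 \<le> S i k" for k
        by (simp add: S_def)
      show "S i k \<le> M" for k
      proof -
        have "card {v. v < length D \<and> D ! v = i \<and> count (l v) i = k} \<le> card {..<length D}"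
          by (rule card_mono) auto
        then show ?thesis
          using assms(6) by (simp add: S_def)
      qed
    qed (use S i in \<open>auto simp: \<sigma>_def\<close>)
    have "\<forall>c\<in>count_system D F \<Delta>. satisfies \<sigma> c"
      unfolding count_iff using cv l(2) by (auto simp: \<sigma>_def)
    moreover have "\<forall>c\<in>loopless_system \<Delta> M. satisfies \<sigma> c"
    proof -
      have "satisfies \<sigma> (edge_sum \<Delta> i i =\<^sub>L frag_cmul 2 (ivar (Pvar i)))" if "i \<in> {1..\<Delta>}" for i
      proof -
        have "even (affine_eval \<sigma> (edge_sum \<Delta> i i))"
          using B that by blast
        moreover have "affine_eval \<sigma> (edge_sum \<Delta> i i) = int (half_edges {..<length D} ((!) D) l i i)"
          using that by (intro e) simp
        moreover have "\<sigma> (Pvar i) = int (half_edges {..<length D} ((!) D) l i i) div 2"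
          by (simp add: \<sigma>_def)
        ultimately show ?thesis
          by simp
      qed
      moreover have "satisfies \<sigma> (frag_cmul 2 (ivar (Zvar (top_index i))) \<le>\<^sub>L edge_sum \<Delta> i i)"
        if "i \<in> {1..\<Delta>}" for i
      proof -
        have "\<sigma> (Zvar (top_index i)) = capped_max (\<lambda>k. affine_eval \<sigma> (mult_sum \<Delta> i k)) i"
          using that by (intro maxmin_system_sound[OF mm[OF that]]) simp
        then show ?thesis
          using B that by simp
      qed
      ultimately show ?thesis
        using mm unfolding loopless_system_def by blast
    qed
    ultimately show "\<exists>\<sigma>. \<forall>c\<in>ip_system D F \<Delta> M. satisfies \<sigma> c"
      using B unfolding ip_system_def by blast
  next
    assume "\<exists>\<sigma>. \<forall>c\<in>ip_system D F \<Delta> M. satisfies \<sigma> c"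
    then obtain \<sigma> where count: "\<forall>c\<in>count_system D F \<Delta>. satisfies \<sigma> c"
      and bip: "\<forall>c\<in>bipartite_system \<Delta>. satisfies \<sigma> c"
      and loopless: "\<forall>c\<in>loopless_system \<Delta> M. satisfies \<sigma> c"
      unfolding ip_system_def by blast
    obtain l where cv: "counts_vertices \<sigma> \<Delta> D l" and F: "\<forall>k<length D. sum_mset (l k) = F ! k"
      using count unfolding count_iff by blast
    have "even (affine_eval \<sigma> (edge_sum \<Delta> i i)) \<and>
        2 * capped_max (\<lambda>k. affine_eval \<sigma> (mult_sum \<Delta> i k)) i \<le> affine_eval \<sigma> (edge_sum \<Delta> i i)"
      if i: "i \<in> {1..\<Delta>}" for i
    proof -
      have "satisfies \<sigma> (edge_sum \<Delta> i i =\<^sub>L frag_cmul 2 (ivar (Pvar i)))"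
        and top: "satisfies \<sigma> (frag_cmul 2 (ivar (Zvar (top_index i))) \<le>\<^sub>L edge_sum \<Delta> i i)"
        and mm: "\<forall>c\<in>maxmin_system \<Delta> M i. satisfies \<sigma> c"
        using loopless i unfolding loopless_system_def by blast+
      then show ?thesis
        using maxmin_system_sound[OF mm] i by simp
    qed
    then have "balanced {..<length D} ((!) D) l"
      using balanced_iff_satisfies[OF D cv] bip by blast
    moreover have "\<forall>k<length D. size (l k) = D ! k"
      using cv unfolding counts_vertices_def by blast
    ultimately show "loopless_multigraph_realizable D F"
      unfolding loopless_multigraph_realizable_iff_balanced using F by blast
  qed
  also have "\<dots> \<longleftrightarrow> ip_feasible (ip_vars \<Delta>) (ip_system D F \<Delta> M)"
    by (rule ip_feasible_iff[symmetric]) (erule ip_system_vars)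
  finally show ?thesis .
qed

end
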